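(* Suppose $\sigma(z,\bar z)=|z|^{2M-2}$ for a positive integer $M$, so that $U=|z|^{2M}/M^2$. Then $F$, regarded as a function of $t_0,t_k,\bar t_k$, satisfies $$4MF=-t_0^2+2Mt_0\,\partial_{t_0}F+\sum_{k\ge1}(2M-k)\big(t_k\partial_{t_k}F+\bar t_k\partial_{\bar t_k}F\big).$$ That is, $F$ is quasihomogeneous of degree $4M$, up to the term $-t_0^2$.
   Context: Let $\gamma$ be a closed simple analytic curve in $\mathbb C$, $D_+$ its interior (assumed to contain $0$) and $D_-$ its exterior. Define the moments - $t_0=\frac1\pi\int_{D_+}\sigma\,d^2z$, - $t_k=\frac{1}{2\pi i k}\oint_\gamma z^{-k}\partial_zU\,dz$ for $k\ge1$, and assume only finitely many $t_k$ are nonzero, - $v_k=\frac1\pi\int_{D_+}z^k\sigma\,d^2z$, - $v_0=\frac2\pi\int_{D_+}\log|z|\,\sigma\,d^2z$. Standing assumption: near a given curve, $(t_0,t_k,\bar t_k)$ (with $\bar t_k$ treated as independent variables) are local coordinates on the space of analytic curves. Define $F=-\frac{1}{\pi^2}\int\!\int_{D_+}\sigma(z,\bar z)\sigma(z',\bar z')\log|z^{-1}-z'^{-1}|\,d^2z\,d^2z'$. *)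

theory Defs
  imports "HOL-Complex_Analysis.Complex_Analysis"
begin

section \<open>Analytic simple closed curves\<close>

text \<open>Closed annulus around the unit circle.\<close>
definition annulus_cl :: "real \<Rightarrow> complex set" where
  "annulus_cl \<delta> = {z. 1 - \<delta> \<le> norm z \<and> norm z \<le> 1 + \<delta>}"

text \<open>The path gamma on [0,1] is the image of the unit circle under a map f that is
  analytic and univalent on a closed annulus of width delta around the unit circle.\<close>
definition analytic_param :: "real \<Rightarrow> (complex \<Rightarrow> complex) \<Rightarrow> (real \<Rightarrow> complex) \<Rightarrow> bool" where
  "analytic_param \<delta> f \<gamma> \<longleftrightarrow> 0 < \<delta> \<and> \<delta> < 1 \<and> f analytic_on annulus_cl \<delta> \<and>
     inj_on f (annulus_cl \<delta>) \<and> (\<forall>t\<in>{0..1}. \<gamma> t = f (cis (2 * pi * t)))"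

definition analytic_curve :: "(real \<Rightarrow> complex) \<Rightarrow> bool" where
  "analytic_curve \<gamma> \<longleftrightarrow> (\<exists>\<delta> f. analytic_param \<delta> f \<gamma>)"

text \<open>Admissible curves: closed simple analytic curves, positively oriented,
  whose interior D+ contains 0.\<close>
definition adm_curve :: "(real \<Rightarrow> complex) \<Rightarrow> bool" where
  "adm_curve \<gamma> \<longleftrightarrow> analytic_curve \<gamma> \<and> simple_path \<gamma> \<and> pathfinish \<gamma> = pathstart \<gamma> \<and>
     0 \<in> inside (path_image \<gamma>) \<and> winding_number \<gamma> 0 = 1"

text \<open>Interior D+ of the curve.\<close>
definition Dplus :: "(real \<Rightarrow> complex) \<Rightarrow> complex set" where
  "Dplus \<gamma> = inside (path_image \<gamma>)"

section \<open>Moments and free energy\<close>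

text \<open>Wirtinger derivative d/dz of a real-valued function on the plane.\<close>
definition wirt_z :: "(complex \<Rightarrow> real) \<Rightarrow> complex \<Rightarrow> complex" where
  "wirt_z U z = (complex_of_real (frechet_derivative U (at z) 1)
                 - \<i> * complex_of_real (frechet_derivative U (at z) \<i>)) / 2"

definition mom_t0 :: "(complex \<Rightarrow> real) \<Rightarrow> complex set \<Rightarrow> real" where
  "mom_t0 \<sigma> D = (LINT z:D|lborel. \<sigma> z) / pi"

definition mom_t :: "(complex \<Rightarrow> real) \<Rightarrow> (real \<Rightarrow> complex) \<Rightarrow> nat \<Rightarrow> complex" where
  "mom_t U \<gamma> k = contour_integral \<gamma> (\<lambda>z. inverse z ^ k * wirt_z U z) / (2 * pi * \<i> * of_nat k)"

definition free_energy :: "(complex \<Rightarrow> real) \<Rightarrow> complex set \<Rightarrow> real" where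
  "free_energy \<sigma> D = - (LINT z:D|lborel. (LINT w:D|lborel.
       \<sigma> z * \<sigma> w * ln (norm (inverse z - inverse w)))) / pi\<^sup>2"

text \<open>The specific density and potential of the theorem.\<close>
definition sigmaM :: "nat \<Rightarrow> complex \<Rightarrow> real" where
  "sigmaM M z = norm z ^ (2 * M - 2)"

definition UM :: "nat \<Rightarrow> complex \<Rightarrow> real" where
  "UM M z = norm z ^ (2 * M) / (real M)\<^sup>2"

section \<open>Coordinates\<close>

text \<open>Coordinates are (t0, (t_{idx i})_i) in real \<times> complex^'n, where idx enumerates the
  finitely many indices k \<ge> 1 for which t_k may be nonzero; all other t_k vanish.\<close>
definition has_coords ::
  "(complex \<Rightarrow> real) \<Rightarrow> (complex \<Rightarrow> real) \<Rightarrow> ('n::finite \<Rightarrow> nat) \<Rightarrow> (real \<Rightarrow> complex)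
     \<Rightarrow> real \<times> (complex ^ 'n) \<Rightarrow> bool" where
  "has_coords \<sigma> U idx \<gamma> c \<longleftrightarrow>
     mom_t0 \<sigma> (Dplus \<gamma>) = fst c \<and>
     (\<forall>i. mom_t U \<gamma> (idx i) = snd c $ i) \<and>
     (\<forall>k. 1 \<le> k \<longrightarrow> k \<notin> range idx \<longrightarrow> mom_t U \<gamma> k = 0)"

text \<open>Partial derivatives of a real function of the coordinates, given its Frechet
  derivative G': derivative in t0, and Wirtinger derivatives in t_k and conj t_k.\<close>
definition d_t0 :: "(real \<times> (complex ^ 'n) \<Rightarrow> real) \<Rightarrow> real" where
  "d_t0 G' = G' (1, 0)"

definition d_tk :: "(real \<times> (complex ^ 'n) \<Rightarrow> real) \<Rightarrow> 'n::finite \<Rightarrow> complex" where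
  "d_tk G' i = (complex_of_real (G' (0, axis i 1)) - \<i> * complex_of_real (G' (0, axis i \<i>))) / 2"

definition d_tkbar :: "(real \<times> (complex ^ 'n) \<Rightarrow> real) \<Rightarrow> 'n::finite \<Rightarrow> complex" where
  "d_tkbar G' i = (complex_of_real (G' (0, axis i 1)) + \<i> * complex_of_real (G' (0, axis i \<i>))) / 2"

end

theory Submission
  imports Defs
begin

(* Dilate the domain by z |-> x z with x > 0. For sigma = |z|^(2M-2) this multiplies
   t_0 by x^(2M), t_k by x^(2M-k), and F by x^(4M) up to an extra term x^(4M) t_0^2 ln x, which
   comes from |1/(xz) - 1/(xw)| = |1/z - 1/w| / x in the logarithmic kernel. By the local
   coordinate hypothesis the dilated curve is the curve with the dilated coordinates, so
   differentiating F along x |-> (x^(2M) t_0, x^(2M-k) t_k) at x = 1 yields the Euler identity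
   4M F + t_0^2 = 2M t_0 dF/dt_0 + sum_k (2M-k) (t_k dF/dt_k + conj t_k dF/d(conj t_k)).
   The rescaling of F needs Fubini for the kernel sigma(z) sigma(w) ln|1/z - 1/w|, which is
   integrable because |ln|v|| has a majorant whose integrals over a ball are bounded uniformly
   in the centre. *)

section \<open>Integrability of the logarithmic kernel\<close>

lemma abs_ln_le_suminf_indicator:
  fixes r :: real
  assumes r: "0 < r" "r < 1"
  shows "ennreal \<bar>ln r\<bar> \<le> (\<Sum>i. indicator {..<(1/2) ^ i} r)"
proof -
  define m where "m = nat \<lceil>- ln r\<rceil>"
  have ln_neg: "ln r < 0"
    using r by simp
  have "r < (1/2) ^ i" if "i < m" for i
  proof -
    have "real i * ln 2 < - ln r"
      using that ln_neg ln_2_less_1 mult_left_le[of "ln 2" "real i"] unfolding m_def by linarith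
    then have "exp (ln r) < exp (- (real i * ln 2))"
      by simp
    also have "exp (- (real i * ln 2)) = (1/2) ^ i"
      by (simp add: exp_minus exp_of_nat_mult power_one_over inverse_eq_divide)
    finally show ?thesis
      using r by simp
  qed
  then have "(\<Sum>i<m. indicator {..<(1/2) ^ i} r :: ennreal) = (\<Sum>i<m. 1)"
    by (intro sum.cong) auto
  then have "ennreal (real m) = (\<Sum>i<m. indicator {..<(1/2) ^ i} r)"
    by (simp add: ennreal_of_nat_eq_real_of_nat)
  also have "\<dots> \<le> (\<Sum>i. indicator {..<(1/2) ^ i} r)"
    by (intro sum_le_suminf) auto
  finally have "ennreal (real m) \<le> (\<Sum>i. indicator {..<(1/2) ^ i} r)" .
  moreover have "\<bar>ln r\<bar> \<le> real m"
    unfolding m_def using ln_neg by linarith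
  ultimately show ?thesis
    by (meson ennreal_leI order_trans)
qed

text \<open>Each ball of radius \<open>2\<^sup>-\<^sup>i\<close> contributes one unit: this dominates \<open>\<bar>ln \<bar>v\<bar>\<bar>\<close> near \<open>0\<close>,
  and since the ball volumes are summable its integral over a ball is bounded uniformly in the
  centre.\<close>
definition ln_majorant :: "real \<Rightarrow> 'a::real_normed_vector \<Rightarrow> ennreal" where
  "ln_majorant \<rho> v = ennreal \<rho> + (\<Sum>i. indicator (ball 0 ((1/2) ^ i)) v)"

lemma abs_ln_norm_le_ln_majorant:
  assumes "norm v \<le> \<rho>"
  shows "ennreal \<bar>ln (norm v)\<bar> \<le> ln_majorant \<rho> v"
proof (cases "v = 0 \<or> 1 \<le> norm v")
  case True
  then have "\<bar>ln (norm v)\<bar> \<le> \<rho>"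
  proof
    assume "v = 0"
    then show ?thesis
      using assms by simp
  next
    assume "1 \<le> norm v"
    then show ?thesis
      using assms ln_le_minus_one[of "norm v"] by (cases "v = 0") auto
  qed
  then show ?thesis
    unfolding ln_majorant_def by (meson add_increasing2 ennreal_leI zero_le)
next
  case False
  then have "ennreal \<bar>ln (norm v)\<bar> \<le> (\<Sum>i. indicator {..<(1/2) ^ i} (norm v))"
    by (intro abs_ln_le_suminf_indicator) auto
  also have "\<dots> = (\<Sum>i. indicator (ball 0 ((1/2) ^ i)) v)"
    by (simp add: indicator_def)
  finally show ?thesis
    unfolding ln_majorant_def by (simp add: add_increasing)
qed

lemma ln_majorant_measurable [measurable]: "ln_majorant \<rho> \<in> borel_measurable borel"
proof -
  have "(\<lambda>v::'a. indicator (ball 0 r) v :: ennreal) \<in> borel_measurable borel" for r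
    by (intro borel_measurable_indicator) simp
  then show ?thesis
    unfolding ln_majorant_def by measurable
qed

lemma suminf_emeasure_dyadic_balls_finite:
  "(\<Sum>i. emeasure lborel (ball (0::'a::euclidean_space) ((1/2) ^ i))) < \<infinity>"
proof -
  have "(1/2::real) ^ DIM('a) < 1"
    using DIM_positive[where 'a='a] by (simp add: power_less_one_iff)
  then have "summable (\<lambda>i. unit_ball_vol DIM('a) * ((1/2::real) ^ DIM('a)) ^ i)"
    by (intro summable_mult summable_geometric) simp
  moreover have "((1/2::real) ^ i) ^ DIM('a) = ((1/2) ^ DIM('a)) ^ i" for i
    by (simp add: power_mult[symmetric] mult.commute)
  ultimately have "summable (\<lambda>i. unit_ball_vol DIM('a) * ((1/2::real) ^ i) ^ DIM('a))"
    by simp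
  then have "(\<Sum>i. ennreal (unit_ball_vol DIM('a) * ((1/2::real) ^ i) ^ DIM('a))) \<noteq> top"
    by (rule ennreal_suminf_neq_top) simp
  then show ?thesis
    by (simp add: emeasure_ball top.not_eq_extremum)
qed

lemma nn_integral_ln_majorant_le:
  fixes a :: "'a::euclidean_space"
  shows "(\<integral>\<^sup>+w. indicator (ball 0 R) w * ln_majorant \<rho> (w - a) \<partial>lborel)
    \<le> ennreal \<rho> * emeasure lborel (ball (0::'a) R) + (\<Sum>i. emeasure lborel (ball (0::'a) ((1/2) ^ i)))"
proof -
  have "(\<integral>\<^sup>+w. indicator (ball 0 R) w * ln_majorant \<rho> (w - a) \<partial>lborel)
      \<le> (\<integral>\<^sup>+w. ennreal \<rho> * indicator (ball 0 R) w + (\<Sum>i. indicator (ball a ((1/2) ^ i)) w) \<partial>lborel)"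
  proof (intro nn_integral_mono)
    fix w :: 'a
    have "(\<Sum>i. indicator (ball 0 ((1/2) ^ i)) (w - a) :: ennreal) = (\<Sum>i. indicator (ball a ((1/2) ^ i)) w)"
      by (simp add: indicator_def dist_norm norm_minus_commute)
    then show "indicator (ball 0 R) w * ln_majorant \<rho> (w - a)
        \<le> ennreal \<rho> * indicator (ball 0 R) w + (\<Sum>i. indicator (ball a ((1/2) ^ i)) w)"
      unfolding ln_majorant_def by (auto simp: indicator_def distrib_left)
  qed
  also have "\<dots> = ennreal \<rho> * emeasure lborel (ball (0::'a) R) + (\<Sum>i. emeasure lborel (ball a ((1/2) ^ i)))"
  proof -
    have [measurable]: "(\<lambda>w. indicator (ball c r) w :: ennreal) \<in> borel_measurable lborel" for c :: 'a and r
      by (intro borel_measurable_indicator) simp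
    show ?thesis
      by (simp add: nn_integral_add nn_integral_suminf nn_integral_cmult_indicator)
  qed
  also have "(\<lambda>i. emeasure lborel (ball a ((1/2) ^ i))) = (\<lambda>i. emeasure lborel (ball (0::'a) ((1/2) ^ i)))"
    by (simp add: emeasure_ball)
  finally show ?thesis .
qed

lemma abs_ln_norm_inverse_diff_le:
  fixes z w :: complex
  shows "\<bar>ln (norm (inverse z - inverse w))\<bar> \<le> \<bar>ln (norm (w - z))\<bar> + \<bar>ln (norm z)\<bar> + \<bar>ln (norm w)\<bar>"
proof (cases "z = 0 \<or> w = 0 \<or> z = w")
  case True
  then show ?thesis
    by (auto simp: norm_inverse ln_inverse norm_minus_commute)
next
  case False
  then have "z \<noteq> 0" "w \<noteq> 0" "w - z \<noteq> 0"
    by auto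
  then have "inverse z - inverse w = (w - z) / (z * w)"
    by (simp add: field_simps)
  then have "ln (norm (inverse z - inverse w)) = ln (norm (w - z)) - ln (norm z) - ln (norm w)"
    using \<open>z \<noteq> 0\<close> \<open>w \<noteq> 0\<close> \<open>w - z \<noteq> 0\<close> by (simp add: norm_divide norm_mult ln_div ln_mult)
  then show ?thesis
    by linarith
qed

definition log_kernel :: "(complex \<Rightarrow> real) \<Rightarrow> complex set \<Rightarrow> complex \<times> complex \<Rightarrow> real" where
  "log_kernel \<sigma> A p = indicator A (fst p) * indicator A (snd p) *
     (\<sigma> (fst p) * \<sigma> (snd p) * ln (norm (inverse (fst p) - inverse (snd p))))"

lemma log_kernel_measurable [measurable]:
  assumes [measurable]: "A \<in> sets borel" "\<sigma> \<in> borel_measurable borel"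
  shows "log_kernel \<sigma> A \<in> borel_measurable lborel"
  unfolding log_kernel_def lborel_prod[symmetric] by measurable

lemma abs_log_kernel_le:
  assumes A: "A \<subseteq> ball 0 R" and \<sigma>: "\<And>z. z \<in> A \<Longrightarrow> \<bar>\<sigma> z\<bar> \<le> C"
  shows "ennreal \<bar>log_kernel \<sigma> A (z, w)\<bar> \<le> ennreal (C\<^sup>2) *
    (indicator (ball 0 R) z * indicator (ball 0 R) w *
      (ln_majorant (2 * R) (w - z) + ln_majorant (2 * R) z + ln_majorant (2 * R) w))"
proof (cases "z \<in> A \<and> w \<in> A")
  case False
  then show ?thesis
    by (auto simp: log_kernel_def)
next
  case True
  then have balls: "z \<in> ball 0 R" "w \<in> ball 0 R"
    using A by auto
  then have "norm z < R" "norm w < R"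
    by auto
  then have norms: "norm (w - z) \<le> 2 * R" "norm z \<le> 2 * R" "norm w \<le> 2 * R"
    using norm_triangle_ineq4[of w z] norm_ge_zero[of z] by linarith+
  have "C \<ge> 0"
    using \<sigma> True by fastforce
  then have "\<bar>log_kernel \<sigma> A (z, w)\<bar>
      \<le> C * C * (\<bar>ln (norm (w - z))\<bar> + \<bar>ln (norm z)\<bar> + \<bar>ln (norm w)\<bar>)"
    using True \<sigma> unfolding log_kernel_def
    by (auto simp: abs_mult intro!: mult_mono abs_ln_norm_inverse_diff_le)
  then have "ennreal \<bar>log_kernel \<sigma> A (z, w)\<bar>
      \<le> ennreal (C\<^sup>2) * (ennreal \<bar>ln (norm (w - z))\<bar> + ennreal \<bar>ln (norm z)\<bar> + ennreal \<bar>ln (norm w)\<bar>)"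
    by (simp add: ennreal_leI power2_eq_square ennreal_mult[symmetric] ennreal_plus[symmetric] del: ennreal_plus)
  also have "\<dots> \<le> ennreal (C\<^sup>2) * (ln_majorant (2 * R) (w - z) + ln_majorant (2 * R) z + ln_majorant (2 * R) w)"
    using norms by (intro mult_left_mono add_mono abs_ln_norm_le_ln_majorant) auto
  finally show ?thesis
    using balls by simp
qed

lemma nn_integral_ln_majorant_pair_finite:
  "(\<integral>\<^sup>+(z::'a::euclidean_space, w). indicator (ball 0 R) z * indicator (ball 0 R) w *
     (ln_majorant \<rho> (w - z) + ln_majorant \<rho> z + ln_majorant \<rho> w) \<partial>lborel) < \<infinity>"
proof -
  define B where "B = ball (0::'a) R"
  define \<psi> :: "'a \<Rightarrow> ennreal" where "\<psi> = ln_majorant \<rho>"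
  define K where "K = ennreal \<rho> * emeasure lborel B + (\<Sum>i. emeasure lborel (ball (0::'a) ((1/2) ^ i)))"
  define G where "G = (\<lambda>(z, w). indicator B z * indicator B w * (\<psi> (w - z) + \<psi> z + \<psi> w))"
  have [measurable]: "B \<in> sets borel" "\<psi> \<in> borel_measurable borel"
    by (simp_all add: B_def \<psi>_def)
  have B: "emeasure lborel B < \<infinity>"
    unfolding B_def by (rule emeasure_lborel_ball_finite)
  have K: "K < \<infinity>"
    using B suminf_emeasure_dyadic_balls_finite[where 'a='a] by (simp add: K_def ennreal_mult_less_top)
  have \<psi>_int: "(\<integral>\<^sup>+w. indicator B w * \<psi> (w - a) \<partial>lborel) \<le> K" for a
    unfolding B_def K_def \<psi>_def by (rule nn_integral_ln_majorant_le)
  have inner: "(\<integral>\<^sup>+w. G (z, w) \<partial>lborel) \<le> 2 * K * indicator B z + emeasure lborel B * (indicator B z * \<psi> z)" for z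
  proof -
    have "(\<integral>\<^sup>+w. G (z, w) \<partial>lborel) = indicator B z *
        ((\<integral>\<^sup>+w. indicator B w * \<psi> (w - z) \<partial>lborel) + \<psi> z * emeasure lborel B
          + (\<integral>\<^sup>+w. indicator B w * \<psi> (w - 0) \<partial>lborel))"
      unfolding G_def
      by (simp add: nn_integral_add nn_integral_cmult nn_integral_multc distrib_left mult.assoc)
         (simp add: ac_simps)
    also have "\<dots> \<le> indicator B z * (K + \<psi> z * emeasure lborel B + K)"
      by (intro mult_left_mono add_mono \<psi>_int) auto
    also have "\<dots> = 2 * K * indicator B z + emeasure lborel B * (indicator B z * \<psi> z)"
      by (simp add: algebra_simps mult_2 mult_2_right)
    finally show ?thesis .
  qed
  have "(\<integral>\<^sup>+p. G p \<partial>lborel) = (\<integral>\<^sup>+z. \<integral>\<^sup>+w. G (z, w) \<partial>lborel \<partial>lborel)"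
    unfolding lborel_prod[symmetric] G_def by (rule lborel.nn_integral_fst[symmetric]) simp
  also have "\<dots> \<le> (\<integral>\<^sup>+z. 2 * K * indicator B z + emeasure lborel B * (indicator B z * \<psi> z) \<partial>lborel)"
    by (intro nn_integral_mono inner)
  also have "\<dots> = 2 * K * emeasure lborel B + emeasure lborel B * (\<integral>\<^sup>+z. indicator B z * \<psi> (z - 0) \<partial>lborel)"
    by (simp add: nn_integral_add nn_integral_cmult nn_integral_cmult_indicator)
  also have "\<dots> \<le> 2 * K * emeasure lborel B + emeasure lborel B * K"
    by (intro add_mono mult_left_mono \<psi>_int) auto
  also have "\<dots> < \<infinity>"
    using B K by (simp add: ennreal_mult_less_top)
  finally show ?thesis
    by (simp add: G_def B_def \<psi>_def case_prod_beta')
qed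

lemma integrable_log_kernel:
  assumes A: "A \<in> sets borel" "bounded A"
    and \<sigma>: "\<sigma> \<in> borel_measurable borel" "\<And>z. z \<in> A \<Longrightarrow> \<bar>\<sigma> z\<bar> \<le> C"
  shows "integrable lborel (log_kernel \<sigma> A)"
proof (rule integrableI_bounded)
  show "log_kernel \<sigma> A \<in> borel_measurable lborel"
    using A \<sigma> by measurable
  obtain R where R: "A \<subseteq> ball 0 R"
    using bounded_subset_ballD[OF A(2)] by blast
  define H where "H = (\<lambda>(z::complex, w). indicator (ball 0 R) z * indicator (ball 0 R) w *
    (ln_majorant (2 * R) (w - z) + ln_majorant (2 * R) z + ln_majorant (2 * R) w))"
  have [measurable]: "ball (0::complex) R \<in> sets borel"
    by simp
  have [measurable]: "H \<in> borel_measurable lborel"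
    unfolding H_def lborel_prod[symmetric] by measurable
  have "(\<integral>\<^sup>+p. ennreal (norm (log_kernel \<sigma> A p)) \<partial>lborel) \<le> (\<integral>\<^sup>+p. ennreal (C\<^sup>2) * H p \<partial>lborel)"
    unfolding H_def by (intro nn_integral_mono) (auto intro: abs_log_kernel_le[OF R \<sigma>(2)])
  also have "\<dots> = ennreal (C\<^sup>2) * (\<integral>\<^sup>+p. H p \<partial>lborel)"
    by (simp add: nn_integral_cmult)
  also have "\<dots> < \<infinity>"
    using nn_integral_ln_majorant_pair_finite[where 'a=complex and R=R and \<rho>="2 * R"]
    by (simp add: H_def ennreal_mult_less_top)
  finally show "(\<integral>\<^sup>+p. ennreal (norm (log_kernel \<sigma> A p)) \<partial>lborel) < \<infinity>" .
qed

lemma free_energy_eq_integral_log_kernel: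
  assumes "integrable lborel (log_kernel \<sigma> A)"
  shows "free_energy \<sigma> A = - integral\<^sup>L lborel (log_kernel \<sigma> A) / pi\<^sup>2"
proof -
  have "integrable (lborel \<Otimes>\<^sub>M lborel) (log_kernel \<sigma> A)"
    using assms by (simp only: lborel_prod)
  then have "(\<integral>z. (\<integral>w. log_kernel \<sigma> A (z, w) \<partial>lborel) \<partial>lborel) = integral\<^sup>L lborel (log_kernel \<sigma> A)"
    by (simp only: lborel_pair.integral_fst' lborel_prod)
  moreover have "(LINT z:A|lborel. (LINT w:A|lborel. \<sigma> z * \<sigma> w * ln (norm (inverse z - inverse w))))
      = (\<integral>z. (\<integral>w. log_kernel \<sigma> A (z, w) \<partial>lborel) \<partial>lborel)"
    unfolding set_lebesgue_integral_def log_kernel_def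
    by (intro Bochner_Integration.integral_cong refl) (simp add: mult.assoc)
  ultimately show ?thesis
    unfolding free_energy_def by simp
qed

definition mass_kernel :: "(complex \<Rightarrow> real) \<Rightarrow> complex set \<Rightarrow> complex \<times> complex \<Rightarrow> real" where
  "mass_kernel \<sigma> A p = indicator A (fst p) * indicator A (snd p) * (\<sigma> (fst p) * \<sigma> (snd p))"

lemma mass_kernel_measurable [measurable]:
  assumes [measurable]: "A \<in> sets borel" "\<sigma> \<in> borel_measurable borel"
  shows "mass_kernel \<sigma> A \<in> borel_measurable lborel"
  unfolding mass_kernel_def lborel_prod[symmetric] by measurable

lemma integrable_mass_kernel:
  assumes A: "A \<in> sets borel" "bounded A"
    and \<sigma>: "\<sigma> \<in> borel_measurable borel" "\<And>z. z \<in> A \<Longrightarrow> \<bar>\<sigma> z\<bar> \<le> C"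
  shows "integrable lborel (mass_kernel \<sigma> A)"
proof (rule integrableI_bounded_set[where A="A \<times> A" and B="C * C"])
  show "A \<times> A \<in> sets lborel"
    using A by (simp add: lborel_prod[symmetric])
  show "emeasure lborel (A \<times> A) < \<infinity>"
    using A by (intro emeasure_bounded_finite) (simp add: bounded_Times)
  show "AE p in lborel. p \<in> A \<times> A \<longrightarrow> norm (mass_kernel \<sigma> A p) \<le> C * C"
  proof (intro AE_I2 impI)
    fix p
    assume p: "p \<in> A \<times> A"
    then have "\<bar>\<sigma> (fst p)\<bar> \<le> C" "\<bar>\<sigma> (snd p)\<bar> \<le> C"
      using \<sigma>(2) by auto
    then have "\<bar>\<sigma> (fst p)\<bar> * \<bar>\<sigma> (snd p)\<bar> \<le> C * C"
      by (intro mult_mono) auto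
    then show "norm (mass_kernel \<sigma> A p) \<le> C * C"
      using p by (auto simp: mass_kernel_def abs_mult)
  qed
  show "AE p in lborel. p \<notin> A \<times> A \<longrightarrow> mass_kernel \<sigma> A p = 0"
    by (intro AE_I2) (auto simp: mass_kernel_def mem_Times_iff)
qed (use A \<sigma> in measurable)

lemma integral_mass_kernel:
  assumes "integrable lborel (mass_kernel \<sigma> A)"
  shows "integral\<^sup>L lborel (mass_kernel \<sigma> A) = (LINT z:A|lborel. \<sigma> z)\<^sup>2"
proof -
  have "integrable (lborel \<Otimes>\<^sub>M lborel) (mass_kernel \<sigma> A)"
    using assms by (simp only: lborel_prod)
  then have "integral\<^sup>L lborel (mass_kernel \<sigma> A) = (\<integral>z. (\<integral>w. mass_kernel \<sigma> A (z, w) \<partial>lborel) \<partial>lborel)"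
    by (simp only: lborel_pair.integral_fst' lborel_prod)
  also have "\<dots> = (\<integral>z. (indicator A z * \<sigma> z) * (LINT w:A|lborel. \<sigma> w) \<partial>lborel)"
  proof (intro Bochner_Integration.integral_cong refl)
    fix z
    have "mass_kernel \<sigma> A (z, w) = (indicator A z * \<sigma> z) * (indicator A w * \<sigma> w)" for w
      by (simp add: mass_kernel_def)
    then show "(\<integral>w. mass_kernel \<sigma> A (z, w) \<partial>lborel) = (indicator A z * \<sigma> z) * (LINT w:A|lborel. \<sigma> w)"
      by (simp add: set_lebesgue_integral_def)
  qed
  also have "\<dots> = (LINT z:A|lborel. \<sigma> z)\<^sup>2"
    unfolding set_lebesgue_integral_def by (simp add: power2_eq_square)
  finally show ?thesis .
qed

section \<open>Dilation of the moments and of the free energy\<close>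

lemma integral_lborel_scaleR:
  fixes g :: "'a::euclidean_space \<Rightarrow> real"
  assumes c: "c > 0" and g[measurable]: "g \<in> borel_measurable borel"
  shows "(\<integral>x. g (c *\<^sub>R x) \<partial>lborel) = integral\<^sup>L lborel g / c ^ DIM('a)"
proof -
  have "lborel = density (distr lborel borel (\<lambda>x::'a. 0 + c *\<^sub>R x)) (\<lambda>_. \<bar>c\<bar> ^ DIM('a))"
    using c by (intro lborel_affine) auto
  then have "integral\<^sup>L lborel g
      = integral\<^sup>L (density (distr lborel borel (\<lambda>x::'a. 0 + c *\<^sub>R x)) (\<lambda>_. \<bar>c\<bar> ^ DIM('a))) g"
    by (rule arg_cong)
  also have "\<dots> = (\<integral>x. \<bar>c\<bar> ^ DIM('a) *\<^sub>R g (0 + c *\<^sub>R x) \<partial>lborel)"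
    using c by (simp add: integral_density integral_distr)
  finally show ?thesis
    using c by simp
qed

lemma AE_lborel_pair_neq: "AE p in (lborel :: ('a::euclidean_space \<times> 'a) measure). fst p \<noteq> snd p"
proof -
  have "open {p::'a \<times> 'a. fst p \<noteq> snd p}"
    by (intro open_Collect_neq continuous_intros)
  then have "{p::'a \<times> 'a. fst p \<noteq> snd p} \<in> sets (lborel \<Otimes>\<^sub>M lborel)"
    unfolding lborel_prod by simp
  moreover have "AE w in lborel. z \<noteq> w" for z :: 'a
    using AE_lborel_singleton[of z] by eventually_elim auto
  then have "AE z in lborel. AE w in lborel. z \<noteq> (w::'a)"
    by simp
  ultimately have "AE p in lborel \<Otimes>\<^sub>M lborel. fst p \<noteq> (snd p::'a)"
    by (intro lborel_pair.AE_pair_measure) (simp_all add: space_pair_measure)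
  then show ?thesis
    by (simp only: lborel_prod)
qed

lemma scaleR_image_in_sets_borel:
  fixes A :: "'a::euclidean_space set"
  assumes "c \<noteq> 0" "A \<in> sets borel"
  shows "(*\<^sub>R) c ` A \<in> sets borel"
proof -
  have "(*\<^sub>R) c ` A = (\<lambda>x. inverse c *\<^sub>R x) -` A"
    using assms(1) by (force simp: image_iff)
  then show ?thesis
    using assms(2) by (simp add: measurable_sets_borel[OF borel_measurable_continuous_onI] continuous_intros)
qed

lemma continuous_abs_le_on_bounded:
  fixes \<sigma> :: "'a::heine_borel \<Rightarrow> real"
  assumes "continuous_on UNIV \<sigma>" "bounded A"
  obtains C where "\<And>z. z \<in> A \<Longrightarrow> \<bar>\<sigma> z\<bar> \<le> C"
proof -
  have "compact (\<sigma> ` closure A)"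
    using assms by (intro compact_continuous_image continuous_on_subset[OF assms(1)]) auto
  then obtain C where "\<And>z. z \<in> closure A \<Longrightarrow> \<bar>\<sigma> z\<bar> \<le> C"
    by (meson bounded_real compact_imp_bounded image_eqI)
  then show ?thesis
    using closure_subset that by blast
qed

lemma mom_t0_scaleR_image:
  assumes \<sigma>: "\<sigma> \<in> borel_measurable borel" and hom: "\<And>z. \<sigma> (c *\<^sub>R z) = c ^ d * \<sigma> z"
    and c: "c > 0" and A: "A \<in> sets borel"
  shows "mom_t0 \<sigma> ((*\<^sub>R) c ` A) = c ^ (d + 2) * mom_t0 \<sigma> A"
proof -
  define g where "g z = indicator ((*\<^sub>R) c ` A) z * \<sigma> z" for z
  have [measurable]: "(*\<^sub>R) c ` A \<in> sets borel"
    using c A by (intro scaleR_image_in_sets_borel) auto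
  have "inj ((*\<^sub>R) c :: complex \<Rightarrow> complex)"
    using c by (auto intro: injI)
  then have "g (c *\<^sub>R z) = c ^ d * (indicator A z * \<sigma> z)" for z
    by (simp add: g_def hom indicator_image)
  then have "(\<integral>z. g (c *\<^sub>R z) \<partial>lborel) = c ^ d * (LINT z:A|lborel. \<sigma> z)"
    by (simp only: integral_mult_right_zero set_lebesgue_integral_def real_scaleR_def)
  moreover have "(\<integral>z. g (c *\<^sub>R z) \<partial>lborel) = integral\<^sup>L lborel g / c ^ DIM(complex)"
    using c \<sigma> by (intro integral_lborel_scaleR) (auto simp: g_def)
  moreover have "(LINT z:(*\<^sub>R) c ` A|lborel. \<sigma> z) = integral\<^sup>L lborel g"
    by (simp add: set_lebesgue_integral_def g_def[abs_def])
  ultimately have "(LINT z:(*\<^sub>R) c ` A|lborel. \<sigma> z) = c ^ (d + 2) * (LINT z:A|lborel. \<sigma> z)"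
    using c by (simp add: field_simps power_add power2_eq_square)
  then show ?thesis
    by (simp add: mom_t0_def)
qed

lemma ln_norm_inverse_diff_scaleR:
  fixes z w :: complex
  assumes "c > 0" "z \<noteq> w"
  shows "ln (norm (inverse (c *\<^sub>R z) - inverse (c *\<^sub>R w))) = ln (norm (inverse z - inverse w)) - ln c"
proof -
  have "inverse (c *\<^sub>R z) - inverse (c *\<^sub>R w) = inverse c *\<^sub>R (inverse z - inverse w)"
    by (simp add: inverse_scaleR_distrib scaleR_diff_right)
  moreover have "inverse z \<noteq> inverse w"
    using assms(2) by simp
  ultimately show ?thesis
    using assms(1) by (simp add: ln_mult ln_inverse)
qed

lemma free_energy_scaleR_image:
  fixes \<sigma> :: "complex \<Rightarrow> real"
  assumes \<sigma>: "continuous_on UNIV \<sigma>" and hom: "\<And>z. \<sigma> (c *\<^sub>R z) = c ^ d * \<sigma> z"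
    and c: "c > 0" and A: "A \<in> sets borel" "bounded A"
  shows "free_energy \<sigma> ((*\<^sub>R) c ` A) = c ^ (2 * d + 4) * (free_energy \<sigma> A + ln c * (mom_t0 \<sigma> A)\<^sup>2)"
proof -
  define cA where "cA = (*\<^sub>R) c ` A"
  have [measurable]: "\<sigma> \<in> borel_measurable borel" "A \<in> sets borel" "cA \<in> sets borel"
    using \<sigma> A c by (auto simp: cA_def borel_measurable_continuous_onI scaleR_image_in_sets_borel)
  have "bounded cA"
    unfolding cA_def using A(2) by (rule bounded_scaling)
  then obtain C' where "\<And>z. z \<in> cA \<Longrightarrow> \<bar>\<sigma> z\<bar> \<le> C'"
    using continuous_abs_le_on_bounded[OF \<sigma>] by blast
  then have int_cA: "integrable lborel (log_kernel \<sigma> cA)"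
    using \<open>bounded cA\<close> by (intro integrable_log_kernel) auto
  obtain C where "\<And>z. z \<in> A \<Longrightarrow> \<bar>\<sigma> z\<bar> \<le> C"
    using continuous_abs_le_on_bounded[OF \<sigma> A(2)] by blast
  then have int_A: "integrable lborel (log_kernel \<sigma> A)" "integrable lborel (mass_kernel \<sigma> A)"
    using A by (auto intro!: integrable_log_kernel integrable_mass_kernel)
  have inj: "inj ((*\<^sub>R) c :: complex \<Rightarrow> complex)"
    using c by (auto intro: injI)
  have "AE p in lborel. log_kernel \<sigma> cA (c *\<^sub>R p)
      = (c ^ d)\<^sup>2 * (log_kernel \<sigma> A p - ln c * mass_kernel \<sigma> A p)"
    using AE_lborel_pair_neq
  proof eventually_elim
    case (elim p)
    then show ?case
      using c inj by (cases p) (simp add: log_kernel_def mass_kernel_def cA_def hom indicator_image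
        ln_norm_inverse_diff_scaleR power2_eq_square algebra_simps)
  qed
  then have "(\<integral>p. log_kernel \<sigma> cA (c *\<^sub>R p) \<partial>lborel)
      = (\<integral>p. (c ^ d)\<^sup>2 * (log_kernel \<sigma> A p - ln c * mass_kernel \<sigma> A p) \<partial>lborel)"
    by (rule integral_cong_AE[rotated 2]) measurable
  also have "\<dots> = (c ^ d)\<^sup>2 * (integral\<^sup>L lborel (log_kernel \<sigma> A) - ln c * (LINT z:A|lborel. \<sigma> z)\<^sup>2)"
    using int_A by (simp add: integral_mass_kernel)
  finally have "integral\<^sup>L lborel (log_kernel \<sigma> cA)
      = c ^ 4 * (c ^ d)\<^sup>2 * (integral\<^sup>L lborel (log_kernel \<sigma> A) - ln c * (LINT z:A|lborel. \<sigma> z)\<^sup>2)"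
    using integral_lborel_scaleR[OF c, of "log_kernel \<sigma> cA"] c by (simp add: field_simps)
  then show ?thesis
    using int_A int_cA
    by (simp add: free_energy_eq_integral_log_kernel mom_t0_def cA_def power_add power_mult
        power2_eq_square field_simps)
qed

lemma wirt_z_UM:
  assumes M: "M \<ge> 1"
  shows "wirt_z (UM M) z = complex_of_real (norm z ^ (2 * M - 2) / real M) * cnj z"
proof -
  have "UM M = (\<lambda>z. (z \<bullet> z) ^ M * inverse ((real M)\<^sup>2))"
    by (simp add: fun_eq_iff UM_def power2_norm_eq_inner[symmetric] power_mult divide_inverse)
  then have "(UM M has_derivative (\<lambda>h. real M * (2 * (z \<bullet> h)) * (z \<bullet> z) ^ (M - 1) * inverse ((real M)\<^sup>2))) (at z)"
    by (auto intro!: derivative_eq_intros simp: inner_commute)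
  moreover have "(z \<bullet> z) ^ (M - 1) = norm z ^ (2 * M - 2)"
    using M by (simp add: power2_norm_eq_inner[symmetric] power_mult[symmetric] diff_mult_distrib2 mult.commute)
  ultimately show ?thesis
    using M by (simp add: wirt_z_def frechet_derivative_at[symmetric] inner_complex_def complex_eq_iff
        power2_eq_square field_simps)
qed

lemma analytic_param_differentiable:
  assumes ap: "analytic_param \<delta> f \<gamma>" and t: "t \<in> {0..1}"
  shows "\<gamma> differentiable (at t within {0..1})"
proof -
  have "(\<lambda>s. cis (2 * pi * s)) differentiable (at t)"
    unfolding differentiable_def
    by (rule exI, rule has_derivative_cis, rule has_derivative_mult_right, rule has_derivative_ident)
  moreover have "cis (2 * pi * t) \<in> annulus_cl \<delta>"
    using ap by (simp add: analytic_param_def annulus_cl_def)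
  then have "f differentiable (at (cis (2 * pi * t)))"
    using ap by (intro field_differentiable_imp_differentiable analytic_on_imp_differentiable_at)
      (auto simp: analytic_param_def)
  ultimately have "(f \<circ> (\<lambda>s. cis (2 * pi * s))) differentiable (at t)"
    by (rule differentiable_chain_at)
  then obtain D where D: "((f \<circ> (\<lambda>s. cis (2 * pi * s))) has_derivative D) (at t within {0..1})"
    unfolding differentiable_def using has_derivative_at_withinI by blast
  have "(\<gamma> has_derivative D) (at t within {0..1})"
    by (rule has_derivative_transform_within[OF D zero_less_one t]) (use ap in \<open>simp add: analytic_param_def\<close>)
  then show ?thesis
    unfolding differentiable_def by blast
qed

lemma contour_integral_scaleR:
  fixes f :: "complex \<Rightarrow> complex"
  assumes c: "c \<noteq> 0" and diff: "\<And>t. t \<in> {0..1} \<Longrightarrow> \<gamma> differentiable (at t within {0..1})"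
    and hom: "\<And>z. f (c *\<^sub>R z) * complex_of_real c = \<mu> * f z" and \<mu>: "\<mu> \<noteq> 0"
  shows "contour_integral (\<lambda>t. c *\<^sub>R \<gamma> t) f = \<mu> * contour_integral \<gamma> f"
proof -
  have integrand: "f (c *\<^sub>R \<gamma> t) * vector_derivative (\<lambda>t. c *\<^sub>R \<gamma> t) (at t within {0..1})
      = \<mu> * (f (\<gamma> t) * vector_derivative \<gamma> (at t within {0..1}))" if t: "t \<in> {0..1}" for t
  proof -
    have "(\<gamma> has_vector_derivative vector_derivative \<gamma> (at t within {0..1})) (at t within {0..1})"
      using diff[OF t] by (simp add: vector_derivative_works)
    then have "((\<lambda>t. c *\<^sub>R \<gamma> t) has_vector_derivative c *\<^sub>R vector_derivative \<gamma> (at t within {0..1}))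
        (at t within {0..1})"
      using has_vector_derivative_scaleR[OF DERIV_const[of c]] by simp
    then have "vector_derivative (\<lambda>t. c *\<^sub>R \<gamma> t) (at t within {0..1})
        = complex_of_real c * vector_derivative \<gamma> (at t within {0..1})"
      using t vector_derivative_within_cbox[of 0 1 t] by (simp add: cbox_interval scaleR_conv_of_real)
    then show ?thesis
      by (simp add: hom[symmetric] mult_ac)
  qed
  have "(f has_contour_integral i) (\<lambda>t. c *\<^sub>R \<gamma> t) \<longleftrightarrow> (f has_contour_integral (i / \<mu>)) \<gamma>" for i
    unfolding has_contour_integral_def has_integral_mult_right_iff[OF \<mu>, symmetric]
    by (intro has_integral_cong integrand)
  then show ?thesis
    using \<mu> by (metis contour_integrable_on_def contour_integral_unique nonzero_mult_div_cancel_left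
        not_integrable_contour_integral mult_zero_right)
qed

lemma mom_t_scaleR:
  assumes "analytic_curve \<gamma>" and c: "c > 0" and M: "M \<ge> 1"
  shows "mom_t (UM M) (\<lambda>t. c *\<^sub>R \<gamma> t) k = complex_of_real (c ^ (2 * M) / c ^ k) * mom_t (UM M) \<gamma> k"
proof -
  obtain \<delta> f where "analytic_param \<delta> f \<gamma>"
    using assms(1) by (auto simp: analytic_curve_def)
  define F where "F z = inverse z ^ k * wirt_z (UM M) z" for z
  have "2 * M = Suc (Suc (2 * M - 2))"
    using M by simp
  then have "c ^ (2 * M) = c ^ (2 * M - 2) * c * c"
    by (metis power_Suc2)
  then have "F (c *\<^sub>R z) * complex_of_real c = complex_of_real (c ^ (2 * M) / c ^ k) * F z" for z
    using c by (simp add: F_def wirt_z_UM[OF M] scaleR_conv_of_real norm_mult power_mult_distrib field_simps)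
  then have "contour_integral (\<lambda>t. c *\<^sub>R \<gamma> t) F = complex_of_real (c ^ (2 * M) / c ^ k) * contour_integral \<gamma> F"
    using c analytic_param_differentiable[OF \<open>analytic_param \<delta> f \<gamma>\<close>]
    by (intro contour_integral_scaleR) auto
  then show ?thesis
    by (simp add: mom_t_def F_def[abs_def])
qed

section \<open>Dilation of admissible curves\<close>

lemma inside_scaleR_image:
  fixes S :: "'a::real_normed_vector set"
  assumes c: "c \<noteq> 0"
  shows "inside ((*\<^sub>R) c ` S) = (*\<^sub>R) c ` inside S"
proof -
  have hom: "homeomorphism (- S) (- ((*\<^sub>R) c ` S)) ((*\<^sub>R) c) ((*\<^sub>R) (inverse c))"
  proof (rule homeomorphismI)
    show "(*\<^sub>R) (inverse c) ` (- ((*\<^sub>R) c ` S)) \<subseteq> - S"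
    proof clarify
      fix y
      assume "y \<notin> (*\<^sub>R) c ` S" "inverse c *\<^sub>R y \<in> S"
      moreover have "y = c *\<^sub>R (inverse c *\<^sub>R y)"
        using c by simp
      ultimately show False
        by blast
    qed
  qed (use c in \<open>auto intro: continuous_intros\<close>)
  have bounded_iff: "bounded ((*\<^sub>R) c ` T) \<longleftrightarrow> bounded T" for T :: "'a set"
    using bounded_scaling[of "(*\<^sub>R) c ` T" "inverse c"] bounded_scaling[of T c] c
    by (auto simp: image_image)
  have mem_iff: "c *\<^sub>R x \<in> inside ((*\<^sub>R) c ` S) \<longleftrightarrow> x \<in> inside S" for x
  proof (cases "x \<in> S")
    case True
    then show ?thesis
      by (auto simp: inside_def)
  next
    case False
    then have "c *\<^sub>R x \<notin> (*\<^sub>R) c ` S"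
      using c by auto
    with False show ?thesis
      using connected_component_set_homeomorphism[OF hom, of x]
      by (simp add: inside_def bounded_iff)
  qed
  show ?thesis
  proof (intro set_eqI iffI)
    fix y
    assume "y \<in> inside ((*\<^sub>R) c ` S)"
    then have "inverse c *\<^sub>R y \<in> inside S"
      using mem_iff[of "inverse c *\<^sub>R y"] c by simp
    then show "y \<in> (*\<^sub>R) c ` inside S"
      using c by (auto simp: image_iff intro!: bexI[of _ "inverse c *\<^sub>R y"])
  qed (use mem_iff in auto)
qed

lemma Dplus_scaleR:
  assumes "c \<noteq> 0"
  shows "Dplus (\<lambda>t. c *\<^sub>R \<gamma> t) = (*\<^sub>R) c ` Dplus \<gamma>"
proof -
  have "path_image (\<lambda>t. c *\<^sub>R \<gamma> t) = (*\<^sub>R) c ` path_image \<gamma>"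
    by (auto simp: path_image_def)
  then show ?thesis
    using assms by (simp add: Dplus_def inside_scaleR_image)
qed

lemma Dplus_open_bounded:
  assumes "adm_curve \<gamma>"
  shows "open (Dplus \<gamma>)" "bounded (Dplus \<gamma>)"
proof -
  have "compact (path_image \<gamma>)"
    using assms by (auto simp: adm_curve_def intro: compact_path_image simple_path_imp_path)
  then show "open (Dplus \<gamma>)" "bounded (Dplus \<gamma>)"
    unfolding Dplus_def by (simp_all add: open_inside compact_imp_closed bounded_inside compact_imp_bounded)
qed

lemma analytic_param_scaleR:
  assumes "analytic_param \<delta> f \<gamma>" "c \<noteq> 0"
  shows "analytic_param \<delta> (\<lambda>z. c *\<^sub>R f z) (\<lambda>t. c *\<^sub>R \<gamma> t)"
  using assms unfolding analytic_param_def
  by (auto simp: scaleR_conv_of_real inj_on_def intro!: analytic_intros)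

lemma zero_notin_closed_segment_scaleR:
  fixes a :: "'a::real_vector"
  assumes "a \<noteq> 0" "c > 0"
  shows "0 \<notin> closed_segment a (c *\<^sub>R a)"
proof
  assume "0 \<in> closed_segment a (c *\<^sub>R a)"
  then obtain u :: real where u: "0 \<le> u" "u \<le> 1" and "((1 - u) + u * c) *\<^sub>R a = 0"
    by (auto simp: closed_segment_def scaleR_add_left)
  moreover have "(1 - u) + u * c > 0"
    using u assms(2) by (cases "u = 1") (auto intro: add_pos_nonneg)
  ultimately show False
    using assms(1) by simp
qed

lemma adm_curve_scaleR:
  assumes adm: "adm_curve \<gamma>" and c: "c > 0"
  shows "adm_curve (\<lambda>t. c *\<^sub>R \<gamma> t)"
proof -
  have simple: "simple_path \<gamma>" and loop: "pathfinish \<gamma> = pathstart \<gamma>"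
    and inside: "0 \<in> inside (path_image \<gamma>)"
    using adm by (auto simp: adm_curve_def)
  have "simple_path (\<lambda>t. c *\<^sub>R \<gamma> t)"
    using simple_path_linear_image_eq[of "(*\<^sub>R) c" \<gamma>] simple c
    by (simp add: o_def linear_scaleR inj_on_def)
  moreover have "pathfinish (\<lambda>t. c *\<^sub>R \<gamma> t) = pathstart (\<lambda>t. c *\<^sub>R \<gamma> t)"
    using loop by (simp add: pathfinish_def pathstart_def)
  moreover have "0 \<in> inside (path_image (\<lambda>t. c *\<^sub>R \<gamma> t))"
    using inside c Dplus_scaleR[of c \<gamma>] by (force simp: Dplus_def)
  moreover have "winding_number (\<lambda>t. c *\<^sub>R \<gamma> t) 0 = winding_number \<gamma> 0"
  proof (rule winding_number_loops_linear_eq)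
    have "0 \<notin> path_image \<gamma>"
      using inside inside_no_overlap by blast
    then show "0 \<notin> closed_segment (\<gamma> t) (c *\<^sub>R \<gamma> t)" if "t \<in> {0..1}" for t
      using that c by (intro zero_notin_closed_segment_scaleR) (auto simp: path_image_def)
  qed (use simple loop \<open>simple_path (\<lambda>t. c *\<^sub>R \<gamma> t)\<close> in \<open>auto intro: simple_path_imp_path simp: pathfinish_def pathstart_def\<close>)
  ultimately show ?thesis
    using adm analytic_param_scaleR[of _ _ \<gamma> c] c
    by (auto simp: adm_curve_def analytic_curve_def)
qed

lemma analytic_param_bounded:
  assumes "analytic_param \<delta> f \<gamma>"
  obtains B where "B > 0" "\<And>z. z \<in> annulus_cl \<delta> \<Longrightarrow> norm (f z) \<le> B"
proof -
  have "annulus_cl \<delta> = cball 0 (1 + \<delta>) - ball 0 (1 - \<delta>)"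
    by (auto simp: annulus_cl_def)
  then have "compact (annulus_cl \<delta>)"
    by (simp add: compact_diff)
  moreover have "continuous_on (annulus_cl \<delta>) f"
    using assms by (intro holomorphic_on_imp_continuous_on analytic_imp_holomorphic) (simp add: analytic_param_def)
  ultimately have "bounded (f ` annulus_cl \<delta>)"
    by (intro compact_imp_bounded compact_continuous_image)
  then show ?thesis
    using that by (auto simp: bounded_pos)
qed

lemma continuous_sigmaM: "continuous_on UNIV (sigmaM M)"
  unfolding sigmaM_def by (intro continuous_intros)

lemma sigmaM_scaleR: "c \<ge> 0 \<Longrightarrow> sigmaM M (c *\<^sub>R z) = c ^ (2 * M - 2) * sigmaM M z"
  by (simp add: sigmaM_def power_mult_distrib)

lemma free_energy_sigmaM_scaleR:
  assumes adm: "adm_curve \<gamma>" and x: "x > 0" and M: "M \<ge> 1"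
  shows "free_energy (sigmaM M) ((*\<^sub>R) x ` Dplus \<gamma>)
    = x ^ (4 * M) * (free_energy (sigmaM M) (Dplus \<gamma>) + ln x * (mom_t0 (sigmaM M) (Dplus \<gamma>))\<^sup>2)"
proof -
  have "2 * (2 * M - 2) + 4 = 4 * M"
    using M by simp
  moreover have "free_energy (sigmaM M) ((*\<^sub>R) x ` Dplus \<gamma>) = x ^ (2 * (2 * M - 2) + 4)
      * (free_energy (sigmaM M) (Dplus \<gamma>) + ln x * (mom_t0 (sigmaM M) (Dplus \<gamma>))\<^sup>2)"
    using Dplus_open_bounded[OF adm] x
    by (intro free_energy_scaleR_image continuous_sigmaM) (simp_all add: sigmaM_scaleR)
  ultimately show ?thesis
    by (simp only:)
qed

section \<open>Differentiating along the dilation\<close>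

lemma norm_axis: "norm (axis i x :: 'a::real_normed_vector ^ 'n::finite) = norm x"
proof -
  have components: "(\<lambda>j. (norm (axis i x $ j))\<^sup>2) = (\<lambda>j. if j = i then (norm x)\<^sup>2 else 0)"
    by (auto simp: axis_def)
  show ?thesis
    unfolding norm_vec_def L2_set_def components by simp
qed

lemma bounded_linear_axis: "bounded_linear (axis i :: 'a::real_normed_vector \<Rightarrow> 'a ^ 'n::finite)"
  by (rule bounded_linear_intro[where K=1]) (simp_all add: vec_eq_iff axis_def norm_axis[unfolded axis_def])

lemma vec_lambda_eq_sum_axis: "(\<chi> i. f i) = (\<Sum>i\<in>UNIV. axis i (f i) :: 'a::comm_monoid_add ^ 'n::finite)"
  by (simp add: vec_eq_iff axis_def if_distrib cong: if_cong)

lemma has_vector_derivative_vec_lambda: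
  fixes f :: "'n::finite \<Rightarrow> real \<Rightarrow> 'a::real_normed_vector"
  assumes "\<And>i. (f i has_vector_derivative f' i) F"
  shows "((\<lambda>x. \<chi> i. f i x) has_vector_derivative (\<chi> i. f' i)) F"
  unfolding vec_lambda_eq_sum_axis
  by (intro has_vector_derivative_sum bounded_linear.has_vector_derivative[OF bounded_linear_axis] assms)

text \<open>The factor \<open>x\<^sup>2\<^sup>M\<^sup>-\<^sup>k\<close> of \<open>t\<^sub>k\<close> is written as a quotient, since \<open>k\<close> may exceed \<open>2M\<close>.\<close>
definition dilate_coords :: "nat \<Rightarrow> ('n::finite \<Rightarrow> nat) \<Rightarrow> real \<Rightarrow> real \<times> (complex ^ 'n) \<Rightarrow> real \<times> (complex ^ 'n)" where
  "dilate_coords M idx x d = (x ^ (2 * M) * fst d, \<chi> i. (x ^ (2 * M) / x ^ idx i) *\<^sub>R snd d $ i)"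

definition euler_vector :: "nat \<Rightarrow> ('n::finite \<Rightarrow> nat) \<Rightarrow> real \<times> (complex ^ 'n) \<Rightarrow> real \<times> (complex ^ 'n)" where
  "euler_vector M idx d = (2 * real M * fst d, \<chi> i. (2 * real M - real (idx i)) *\<^sub>R snd d $ i)"

lemma dilate_coords_one [simp]: "dilate_coords M idx 1 d = d"
  by (simp add: dilate_coords_def prod_eq_iff vec_eq_iff)

lemma has_coords_scaleR:
  assumes coords: "has_coords (sigmaM M) (UM M) idx \<gamma> d" and adm: "adm_curve \<gamma>"
    and x: "x > 0" and M: "M \<ge> 1"
  shows "has_coords (sigmaM M) (UM M) idx (\<lambda>t. x *\<^sub>R \<gamma> t) (dilate_coords M idx x d)"
proof -
  have deg: "2 * M - 2 + 2 = 2 * M"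
    using M by simp
  have dilated: "Dplus (\<lambda>t. x *\<^sub>R \<gamma> t) = (*\<^sub>R) x ` Dplus \<gamma>"
    using x by (simp add: Dplus_scaleR)
  have "mom_t0 (sigmaM M) ((*\<^sub>R) x ` Dplus \<gamma>) = x ^ (2 * M - 2 + 2) * mom_t0 (sigmaM M) (Dplus \<gamma>)"
    using Dplus_open_bounded[OF adm] x
    by (intro mom_t0_scaleR_image) (simp_all add: sigmaM_scaleR borel_measurable_continuous_onI continuous_sigmaM)
  then have t0: "mom_t0 (sigmaM M) (Dplus (\<lambda>t. x *\<^sub>R \<gamma> t)) = x ^ (2 * M) * mom_t0 (sigmaM M) (Dplus \<gamma>)"
    by (simp only: deg dilated)
  have "analytic_curve \<gamma>"
    using adm by (simp add: adm_curve_def)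
  then have tk: "mom_t (UM M) (\<lambda>t. x *\<^sub>R \<gamma> t) k = (x ^ (2 * M) / x ^ k) *\<^sub>R mom_t (UM M) \<gamma> k" for k
    using mom_t_scaleR[OF _ x M] by (simp add: scaleR_conv_of_real)
  show ?thesis
    using coords unfolding has_coords_def t0 tk by (simp add: dilate_coords_def)
qed

lemma has_vector_derivative_dilate_coords:
  "((\<lambda>x. dilate_coords M idx x d) has_vector_derivative euler_vector M idx d) (at 1)"
proof -
  have "((\<lambda>x. x ^ (2 * M) / x ^ k) has_real_derivative (2 * real M - real k)) (at 1)" for k
    using DERIV_divide[OF DERIV_pow[of "2 * M" 1] DERIV_pow[of k 1]] by simp
  then show ?thesis
    unfolding dilate_coords_def euler_vector_def
    by (intro has_vector_derivative_Pair has_vector_derivative_vec_lambda has_vector_derivative_scaleR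
        has_vector_derivative_const)
      (auto intro!: derivative_eq_intros simp: has_real_derivative_iff_has_vector_derivative[symmetric])
qed

lemma linear_coords_expansion:
  fixes G' :: "real \<times> (complex ^ 'n::finite) \<Rightarrow> real"
  assumes lin: "linear G'"
  shows "complex_of_real (G' (a, w)) = complex_of_real (a * d_t0 G')
    + (\<Sum>i\<in>UNIV. w $ i * d_tk G' i + cnj (w $ i) * d_tkbar G' i)"
proof -
  have "(a, w) = a *\<^sub>R (1, 0) + (\<Sum>i\<in>UNIV. Re (w $ i) *\<^sub>R (0, axis i 1) + Im (w $ i) *\<^sub>R (0, axis i \<i>))"
    by (simp add: prod_eq_iff vec_eq_iff fst_sum snd_sum axis_def if_distrib complex_eq_iff cong: if_cong)
  then have "G' (a, w) = G' (a *\<^sub>R (1, 0) + (\<Sum>i\<in>UNIV. Re (w $ i) *\<^sub>R (0, axis i 1) + Im (w $ i) *\<^sub>R (0, axis i \<i>)))"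
    by (rule arg_cong)
  also have "\<dots> = a * d_t0 G' + (\<Sum>i\<in>UNIV. Re (w $ i) * G' (0, axis i 1) + Im (w $ i) * G' (0, axis i \<i>))"
    unfolding d_t0_def
    by (simp only: linear_add[OF lin] linear_sum[OF lin] linear_scale[OF lin] o_def real_scaleR_def)
  finally have "complex_of_real (G' (a, w)) = complex_of_real (a * d_t0 G')
      + (\<Sum>i\<in>UNIV. complex_of_real (Re (w $ i) * G' (0, axis i 1) + Im (w $ i) * G' (0, axis i \<i>)))"
    by simp
  moreover have "complex_of_real (Re v * G' (0, axis i 1) + Im v * G' (0, axis i \<i>))
      = v * d_tk G' i + cnj v * d_tkbar G' i" for v i
    by (simp add: d_tk_def d_tkbar_def complex_eq_iff field_simps)
  ultimately show ?thesis
    by simp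
qed

lemma eventually_Dplus_chart_dilate:
  assumes M: "M \<ge> 1" and S: "open S" "c \<in> S"
    and chart: "\<forall>d\<in>S. adm_curve (\<Phi> d) \<and> has_coords (sigmaM M) (UM M) idx (\<Phi> d) d"
    and local: "\<exists>\<delta> \<epsilon> f. \<epsilon> > 0 \<and> analytic_param \<delta> f (\<Phi> c) \<and>
       (\<forall>e\<in>S. \<forall>\<gamma> g. adm_curve \<gamma> \<and> has_coords (sigmaM M) (UM M) idx \<gamma> e \<and>
          analytic_param \<delta> g \<gamma> \<and> (\<forall>z\<in>annulus_cl \<delta>. norm (g z - f z) < \<epsilon>)
          \<longrightarrow> Dplus \<gamma> = Dplus (\<Phi> e))"
  shows "\<forall>\<^sub>F x in nhds 1. Dplus (\<Phi> (dilate_coords M idx x c)) = (*\<^sub>R) x ` Dplus (\<Phi> c)"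
proof -
  obtain \<delta> \<epsilon> f where \<epsilon>: "\<epsilon> > 0" and f: "analytic_param \<delta> f (\<Phi> c)"
    and unique: "\<forall>e\<in>S. \<forall>\<gamma> g. adm_curve \<gamma> \<and> has_coords (sigmaM M) (UM M) idx \<gamma> e \<and>
       analytic_param \<delta> g \<gamma> \<and> (\<forall>z\<in>annulus_cl \<delta>. norm (g z - f z) < \<epsilon>) \<longrightarrow> Dplus \<gamma> = Dplus (\<Phi> e)"
    using local by blast
  obtain B where B: "B > 0" "\<And>z. z \<in> annulus_cl \<delta> \<Longrightarrow> norm (f z) \<le> B"
    using analytic_param_bounded[OF f] by blast
  have "((\<lambda>x. dilate_coords M idx x c) \<longlongrightarrow> dilate_coords M idx 1 c) (at 1)"
    using has_vector_derivative_continuous[OF has_vector_derivative_dilate_coords] by (simp add: isCont_def)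
  then have "((\<lambda>x. dilate_coords M idx x c) \<longlongrightarrow> dilate_coords M idx 1 c) (nhds 1)"
    using tendsto_at_iff_tendsto_nhds[of "\<lambda>x. dilate_coords M idx x c" 1] by simp
  then have "\<forall>\<^sub>F x in nhds 1. dilate_coords M idx x c \<in> S"
    using S by (intro topological_tendstoD) simp_all
  moreover have "\<forall>\<^sub>F x in nhds 1. 0 < x \<and> \<bar>x - 1\<bar> * B < \<epsilon>"
    unfolding eventually_nhds_metric
    by (rule exI[of _ "min 1 (\<epsilon> / B)"]) (use B \<epsilon> in \<open>auto simp: dist_real_def field_simps\<close>)
  ultimately show ?thesis
  proof eventually_elim
    case (elim x)
    then have x: "x > 0" and close: "\<bar>x - 1\<bar> * B < \<epsilon>"
      by auto
    have near: "\<forall>z\<in>annulus_cl \<delta>. norm (x *\<^sub>R f z - f z) < \<epsilon>"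
    proof
      fix z
      assume z: "z \<in> annulus_cl \<delta>"
      have "norm (x *\<^sub>R f z - f z) = \<bar>x - 1\<bar> * norm (f z)"
        by (metis norm_scaleR scaleR_diff_left scaleR_one)
      also have "\<dots> \<le> \<bar>x - 1\<bar> * B"
        using B(2)[OF z] by (intro mult_left_mono) auto
      finally show "norm (x *\<^sub>R f z - f z) < \<epsilon>"
        using close by linarith
    qed
    have "adm_curve (\<Phi> c)" "has_coords (sigmaM M) (UM M) idx (\<Phi> c) c"
      using chart S(2) by auto
    then have "adm_curve (\<lambda>t. x *\<^sub>R \<Phi> c t)"
      and "has_coords (sigmaM M) (UM M) idx (\<lambda>t. x *\<^sub>R \<Phi> c t) (dilate_coords M idx x c)"
      using x M by (simp_all add: adm_curve_scaleR has_coords_scaleR)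
    moreover have "analytic_param \<delta> (\<lambda>z. x *\<^sub>R f z) (\<lambda>t. x *\<^sub>R \<Phi> c t)"
      using f x by (simp add: analytic_param_scaleR)
    ultimately have "Dplus (\<lambda>t. x *\<^sub>R \<Phi> c t) = Dplus (\<Phi> (dilate_coords M idx x c))"
      using unique elim near by blast
    then show ?case
      using x by (simp add: Dplus_scaleR)
  qed
qed

lemma has_real_derivative_dilate_coords_comp:
  assumes "(F has_derivative G') (at c)"
  shows "((\<lambda>x. F (dilate_coords M idx x c)) has_real_derivative G' (euler_vector M idx c)) (at 1)"
proof -
  have "((\<lambda>x. dilate_coords M idx x c) has_derivative (\<lambda>h. h *\<^sub>R euler_vector M idx c)) (at 1)"
    using has_vector_derivative_dilate_coords by (simp add: has_vector_derivative_def)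
  moreover have "(F has_derivative G') (at (dilate_coords M idx 1 c))"
    using assms by simp
  ultimately have "((\<lambda>x. F (dilate_coords M idx x c)) has_derivative (\<lambda>h. G' (h *\<^sub>R euler_vector M idx c))) (at 1)"
    by (rule has_derivative_compose)
  moreover have "(\<lambda>h. G' (h *\<^sub>R euler_vector M idx c)) = (*) (G' (euler_vector M idx c))"
    using linear_scale[OF has_derivative_linear[OF assms]] by (simp add: fun_eq_iff)
  ultimately show ?thesis
    by (simp add: has_field_derivative_def)
qed

theorem mainTheorem3:
  fixes M :: nat
    and idx :: "'n::finite \<Rightarrow> nat"
    and S :: "(real \<times> (complex ^ 'n)) set"
    and \<Phi> :: "real \<times> (complex ^ 'n) \<Rightarrow> real \<Rightarrow> complex"
    and c :: "real \<times> (complex ^ 'n)"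
    and G' :: "real \<times> (complex ^ 'n) \<Rightarrow> real"
  assumes M_pos: "M \<ge> 1"
    and idx_inj: "inj idx"
    and idx_pos: "\<forall>i. 1 \<le> idx i"
    and S_open: "open S"
    and c_in: "c \<in> S"
    and chart: "\<forall>d\<in>S. adm_curve (\<Phi> d) \<and> has_coords (sigmaM M) (UM M) idx (\<Phi> d) d"
    and local_coords:
      "\<forall>d\<in>S. \<exists>\<delta> \<epsilon> f. \<epsilon> > 0 \<and> analytic_param \<delta> f (\<Phi> d) \<and>
         (\<forall>e\<in>S. \<forall>\<gamma> g. adm_curve \<gamma> \<and> has_coords (sigmaM M) (UM M) idx \<gamma> e \<and>
            analytic_param \<delta> g \<gamma> \<and> (\<forall>z\<in>annulus_cl \<delta>. norm (g z - f z) < \<epsilon>)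
            \<longrightarrow> Dplus \<gamma> = Dplus (\<Phi> e))"
    and F_diff: "((\<lambda>d. free_energy (sigmaM M) (Dplus (\<Phi> d))) has_derivative G') (at c)"
  shows "complex_of_real (4 * real M * free_energy (sigmaM M) (Dplus (\<Phi> c)))
     = complex_of_real (- (fst c)\<^sup>2 + 2 * real M * fst c * d_t0 G')
       + (\<Sum>i\<in>UNIV. (2 * of_nat M - of_nat (idx i)) *
            (snd c $ i * d_tk G' i + cnj (snd c $ i) * d_tkbar G' i))"
proof -
  define F where "F x = free_energy (sigmaM M) (Dplus (\<Phi> (dilate_coords M idx x c)))" for x
  have "\<forall>\<^sub>F x in nhds 1. Dplus (\<Phi> (dilate_coords M idx x c)) = (*\<^sub>R) x ` Dplus (\<Phi> c)"
    using M_pos S_open c_in chart local_coords by (intro eventually_Dplus_chart_dilate) auto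
  moreover have "\<forall>\<^sub>F x in nhds (1::real). x > 0"
    using eventually_nhds_in_open[of "{0<..}" "1::real"] by simp
  ultimately have "\<forall>\<^sub>F x in nhds 1. F x = x ^ (4 * M) * (F 1 + ln x * (fst c)\<^sup>2)"
  proof eventually_elim
    case (elim x)
    then show ?case
      using chart c_in M_pos
      by (simp add: F_def free_energy_sigmaM_scaleR has_coords_def)
  qed
  moreover have "((\<lambda>x. x ^ (4 * M) * (F 1 + ln x * (fst c)\<^sup>2)) has_real_derivative 4 * real M * F 1 + (fst c)\<^sup>2) (at 1)"
    using DERIV_mult[OF DERIV_pow[of "4 * M" 1] DERIV_add[OF DERIV_const DERIV_cmult_right[OF DERIV_ln]]]
    by simp
  ultimately have "(F has_real_derivative 4 * real M * F 1 + (fst c)\<^sup>2) (at 1)"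
    by (rule DERIV_cong_ev[OF refl _ refl, THEN iffD2])
  moreover have "(F has_real_derivative G' (euler_vector M idx c)) (at 1)"
    unfolding F_def by (rule has_real_derivative_dilate_coords_comp[OF F_diff])
  ultimately have "G' (euler_vector M idx c) = 4 * real M * F 1 + (fst c)\<^sup>2"
    by (rule DERIV_unique[rotated])
  moreover have "complex_of_real (G' (euler_vector M idx c)) = complex_of_real (2 * real M * fst c * d_t0 G')
      + (\<Sum>i\<in>UNIV. (2 * of_nat M - of_nat (idx i)) * (snd c $ i * d_tk G' i + cnj (snd c $ i) * d_tkbar G' i))"
    unfolding euler_vector_def linear_coords_expansion[OF has_derivative_linear[OF F_diff]]
    by (simp add: scaleR_conv_of_real algebra_simps)
  ultimately show ?thesis
    by (simp add: F_def algebra_simps)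
qed

end
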